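(* Let $q=p^k$ for some prime $p$ and some integer $k>0$. Let $Q,R,S$ be integers each of the form $p^i$ for some integer $i\ge 0$ (the exponents may differ). Let $r>0$ be an integer with $r\equiv Q+R+S\pmod{q+1}$. Let $m\ge 3$ be an integer with $q\equiv 1\pmod m$ or $q\equiv -1\pmod m$. Let $v$ be a primitive $m$-th root of unity in $\mathbb{F}_{q^2}$ and put $b:=(1-v^4)/(v^3-v)$; then $b\in\{0,1,-1\}$ if and only if $m\in\{3,4,6\}$. Let $f(X):=X^rB(X^{q-1})$, where one of the following holds: (1) $B(X):=X^{Q+R+S}-X^Q-X^R-X^S+b$ and $(Q,R,S)\equiv\pm(1,1,1)\pmod m$; (2) $B(X):=X^{Q+R}-X^{Q+S}-X^{R+S}+bX^S-1$ and $(Q,R,S)\equiv\pm(1,1,-1)\pmod m$. Then $f(X)$ permutes $\mathbb{F}_{q^2}$ if and only if $\gcd(r,q-1)=1$ and one of the following holds: (i) $q\equiv 1\pmod m$ and $\gcd(Q+R+S,q+1)=1$; (ii) $q\equiv -1\pmod m$ and $\gcd(Q+R+S,q-1)=1$.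
   Context: A polynomial $f(X)\in\mathbb{F}_{q^2}[X]$ permutes $\mathbb{F}_{q^2}$ if the map $\alpha\mapsto f(\alpha)$ is a bijection of $\mathbb{F}_{q^2}$. For integers $\epsilon_1,\epsilon_2,\epsilon_3$, the notation $(Q,R,S)\equiv\pm(\epsilon_1,\epsilon_2,\epsilon_3)\pmod m$ means that there is a single sign $s\in\{1,-1\}$ with $Q\equiv s\epsilon_1$, $R\equiv s\epsilon_2$, $S\equiv s\epsilon_3\pmod m$. *)

theory Defs
  imports
    "HOL-Computational_Algebra.Computational_Algebra"
    "HOL-Number_Theory.Cong"
begin

definition primitive_root_of_unity :: "nat \<Rightarrow> 'a::field \<Rightarrow> bool" where
  "primitive_root_of_unity m v \<longleftrightarrow> m > 0 \<and> v ^ m = 1 \<and> (\<forall>j. 0 < j \<and> j < m \<longrightarrow> v ^ j \<noteq> 1)"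

definition permutation_polynomial :: "'a::field poly \<Rightarrow> bool" where
  "permutation_polynomial f \<longleftrightarrow> bij (poly f)"

(* One common sign s serves all three congruences. *)
definition cong_pm3 :: "int \<times> int \<times> int \<Rightarrow> int \<times> int \<times> int \<Rightarrow> int \<Rightarrow> bool" where
  "cong_pm3 = (\<lambda>(Q, R, S) (e1, e2, e3) m.
     \<exists>s\<in>{1, -1}. [Q = s * e1] (mod m) \<and> [R = s * e2] (mod m) \<and> [S = s * e3] (mod m))"

abbreviation X_pow :: "nat \<Rightarrow> 'a::field poly" where
  "X_pow n \<equiv> monom 1 n"

end

theory Submission
  imports Defs
begin

text \<open>
  Write \<open>n = Q + R + S\<close> and call \<open>t\<close> of norm one if \<open>t ^ (q + 1) = 1\<close>. The power map
  \<open>x \<mapsto> x ^ (q - 1)\<close> sends the units of the field onto the norm-one elements with fibres of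
  size \<open>q - 1\<close>, and \<open>f\<close> respects these fibres. Hence, if \<open>B\<close> has no root of norm one, \<open>f\<close> is a
  permutation if and only if \<open>r\<close> is coprime to \<open>q - 1\<close> and \<open>g(t) = t ^ r * B(t) ^ (q - 1)\<close> is
  injective on the norm-one elements (lemma \<open>permutation_criterion\<close>). The congruence for \<open>r\<close>
  gives \<open>g(t) = t ^ n * B(t) ^ q / B(t)\<close> there.

  The point of the coefficient \<open>b = - (v + 1 / v)\<close> is that both the numerator and the
  denominator of this quotient are combinations of two products of linear forms,
  \<open>X = (t ^ Q + v) (t ^ R + v) (t ^ S + v)\<close> and
  \<open>Y = (v t ^ Q + 1) (v t ^ R + 1) (v t ^ S + 1)\<close>, with the forms in \<open>t ^ S\<close> interchanged for
  the second family: up to a common constant, \<open>B = v X - Y\<close> and \<open>t ^ n * B ^ q = v Y - X\<close>.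
  Since \<open>Q\<close>, \<open>R\<close>, \<open>S\<close> are powers of the characteristic, and since the congruences modulo \<open>m\<close> say
  that the corresponding power maps fix or invert \<open>v\<close>, the products collapse: \<open>X\<close> and \<open>Y\<close> are
  proportional to \<open>(t + v) ^ n\<close> and \<open>(v t + 1) ^ n\<close>, in this order or in the other one. With
  \<open>\<sigma>(t) = (t + v) / (v t + 1)\<close> it follows that \<open>g\<close> is a function of degree one composed with
  \<open>\<sigma>(t) ^ n\<close> or its reciprocal (lemmas \<open>linear_factor_frobenius\<close>, \<open>permutation_iff_coprime\<close>).

  What remains is the injectivity of \<open>\<sigma>(t) ^ n\<close>. If \<open>q \<equiv> 1\<close> modulo \<open>m\<close>, then \<open>v\<close> lies in the
  subfield of \<open>q\<close> elements and \<open>\<sigma>\<close> permutes the norm-one group, of order \<open>q + 1\<close>. If \<open>q \<equiv> -1\<close>,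
  then \<open>v\<close> has norm one and \<open>\<sigma>\<close> identifies the norm-one group with the projective line over
  the subfield, whose unit group has order \<open>q - 1\<close>. This accounts for the two gcd conditions
  (lemma \<open>moebius_injective_iff_coprime\<close>).
\<close>

section \<open>Roots of unity in finite fields\<close>

lemma power_cong_exponent:
  fixes z :: "'a::monoid_mult"
  assumes "z ^ e = 1" and "[a = b] (mod e)"
  shows "z ^ a = z ^ b"
proof -
  have "z ^ c = z ^ (c mod e)" for c
  proof -
    have "z ^ c = z ^ (e * (c div e) + c mod e)"
      by (simp only: mult_div_mod_eq)
    also have "\<dots> = z ^ (c mod e)"
      by (simp only: power_add[of z "e * (c div e)"] power_mult assms(1) power_one mult_1_left)
    finally show ?thesis .
  qed
  then show ?thesis using assms(2) unfolding cong_def by metis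
qed

lemma power_eq_1_coprime:
  fixes z :: "'a::field"
  assumes "z ^ a = 1" "z ^ b = 1" "coprime a b"
  shows "z = 1"
proof (cases "a = 0")
  case True
  then show ?thesis using assms by simp
next
  case False
  then obtain x y where "a * x = b * y + gcd a b"
    using bezout_nat by blast
  then have "z ^ (a * x) = z ^ (b * y) * z"
    using assms(3) by simp
  then show ?thesis using assms by (simp add: power_mult)
qed

lemma power_inj_coprime:
  fixes y z :: "'a::field"
  assumes "y \<noteq> 0" "z \<noteq> 0" "y ^ a = z ^ a" "y ^ b = z ^ b" "coprime a b"
  shows "y = z"
proof -
  have "(y / z) ^ a = 1" "(y / z) ^ b = 1"
    using assms by (simp_all add: power_divide)
  then have "y / z = 1" using assms(5) by (rule power_eq_1_coprime)
  then show ?thesis using assms(2) by simp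
qed

lemma finite_field_power_card_minus_1:
  fixes x :: "'a::finite_field"
  assumes "x \<noteq> 0"
  shows "x ^ (card (UNIV :: 'a set) - 1) = 1"
proof -
  have "card (UNIV :: 'a set) = Suc (card (UNIV :: 'a set) - 1)"
    by (simp add: card_gt_0_iff)
  then have "x * x ^ (card (UNIV :: 'a set) - 1) = x"
    by (metis finite_field_power_card_eq_same power_Suc)
  then show ?thesis using assms by simp
qed

text \<open>
  A weak form of the cyclicity of the unit group: it produces the collisions that refute
  injectivity whenever one of the gcd conditions fails.
\<close>

lemma exists_nontrivial_root_of_unity:
  assumes "d dvd card (UNIV :: 'a::finite_field set) - 1" "d > 1"
  shows "\<exists>z :: 'a. z \<noteq> 1 \<and> z ^ d = 1"
proof -
  define N where "N = card (UNIV :: 'a set) - 1"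
  obtain a where a: "N = d * a" using assms(1) by (auto simp: N_def)
  have "N > 0"
  proof -
    have "card {0, 1 :: 'a} \<le> card (UNIV :: 'a set)" by (rule card_mono) auto
    then show ?thesis by (simp add: N_def)
  qed
  then have "a > 0" "a < N" using a assms(2) by (auto intro: Nat.gr0I)
  define P :: "'a poly" where "P = X_pow a + [:- 1:]"
  have dP: "degree P = a"
    unfolding P_def using \<open>a > 0\<close> by (subst degree_add_eq_left) (simp_all add: degree_monom_eq)
  then have P0: "P \<noteq> 0" using \<open>a > 0\<close> by auto
  \<comment> \<open>Otherwise all \<open>N\<close> units would be roots of \<open>P\<close>, whose degree \<open>a\<close> is smaller.\<close>
  have "\<exists>x :: 'a. x \<noteq> 0 \<and> x ^ a \<noteq> 1"
  proof (rule ccontr)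
    assume "\<not> ?thesis"
    then have "UNIV - {0} \<subseteq> {x. poly P x = 0}" by (auto simp: P_def poly_monom)
    then have "card (UNIV - {0 :: 'a}) \<le> card {x. poly P x = 0}"
      by (intro card_mono poly_roots_finite P0) auto
    also have "\<dots> \<le> a" using card_poly_roots_bound[OF P0] dP by simp
    finally show False using \<open>a < N\<close> by (simp add: N_def)
  qed
  then obtain x :: 'a where x: "x \<noteq> 0" "x ^ a \<noteq> 1" by blast
  have "(x ^ a) ^ d = x ^ N" by (simp add: a mult.commute flip: power_mult)
  also have "\<dots> = 1" unfolding N_def by (rule finite_field_power_card_minus_1[OF x(1)])
  finally show ?thesis using x(2) by blast
qed

text \<open>
  Translating by \<open>1\<close> permutes the field, so the sum of all elements does not change when the
  cardinality is added to it; hence the characteristic divides the cardinality.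
\<close>

lemma CHAR_eq_of_card_prime_power:
  assumes "prime p" "card (UNIV :: 'a::finite_field set) = p ^ j"
  shows "CHAR('a) = p"
proof -
  have "(\<Sum>x\<in>UNIV. x) = (\<Sum>x\<in>UNIV. x + (1 :: 'a))"
    by (rule sum.reindex_bij_witness[of _ "\<lambda>x. x + 1" "\<lambda>x. x - 1"]) auto
  then have "of_nat (card (UNIV :: 'a set)) = (0 :: 'a)"
    by (simp add: sum.distrib)
  then have "CHAR('a) dvd p ^ j"
    unfolding assms(2) of_nat_eq_0_iff_char_dvd .
  then have "CHAR('a) dvd p" using CHAR_prime prime_dvd_power by blast
  then show ?thesis using assms(1) by (simp add: primes_dvd_imp_eq)
qed

lemma frobenius_add:
  fixes x y :: "'a::finite_field"
  shows "(x + y) ^ (CHAR('a) ^ i) = x ^ (CHAR('a) ^ i) + y ^ (CHAR('a) ^ i)"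
  by (rule freshmans_dream') auto

lemma frobenius_diff:
  fixes x y :: "'a::finite_field"
  shows "(x - y) ^ (CHAR('a) ^ i) = x ^ (CHAR('a) ^ i) - y ^ (CHAR('a) ^ i)"
  using frobenius_add[of "x - y" y i] by simp

section \<open>Reduction to the elements of norm one\<close>

text \<open>
  Hilbert 90 for the quadratic extension: with \<open>x = t w + w\<^sup>q\<close> the relation \<open>t * t\<^sup>q = 1\<close> gives
  \<open>t x\<^sup>q = x\<close>, so \<open>1 / x\<close> is the desired element. The only difficulty is to make \<open>x\<close> nonzero, and
  \<open>t w + w\<^sup>q\<close> is a polynomial in \<open>w\<close> of degree \<open>q\<close>, which cannot vanish at all \<open>q\<^sup>2\<close> points.
\<close>

lemma hilbert_90:
  fixes t :: "'a::finite_field"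
  assumes q: "q = CHAR('a) ^ k" and card: "card (UNIV :: 'a set) = q ^ 2"
    and "q > 1" and t: "t ^ (q + 1) = 1"
  shows "\<exists>x. x \<noteq> 0 \<and> x ^ (q - 1) = t"
proof -
  have t0: "t \<noteq> 0" using t by (metis add_gr_0 less_one power_0_left zero_neq_one less_not_refl)
  have sq: "(w ^ q) ^ q = w" for w :: 'a
    using finite_field_power_card_eq_same[of w] card by (simp add: power2_eq_square power_mult)
  define P :: "'a poly" where "P = monom 1 q + monom t 1"
  have dP: "degree P = q" unfolding P_def
    using \<open>q > 1\<close> t0 by (subst degree_add_eq_left) (simp_all add: degree_monom_eq)
  then have P0: "P \<noteq> 0" using \<open>q > 1\<close> by auto
  have "\<exists>w. poly P w \<noteq> 0"
  proof (rule ccontr)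
    assume "\<not> ?thesis"
    then have "{x. poly P x = 0} = UNIV" by auto
    then have "q ^ 2 \<le> q" using card_poly_roots_bound[OF P0] dP card by simp
    then show False using \<open>q > 1\<close> by (simp add: power2_eq_square)
  qed
  then obtain w where w: "t * w + w ^ q \<noteq> 0" by (auto simp: P_def poly_monom add.commute)
  define x where "x = t * w + w ^ q"
  have "t * x ^ q = t ^ (q + 1) * w ^ q + t * w"
    unfolding x_def by (simp add: q frobenius_add flip: q) 
       (simp add: q frobenius_add power_mult_distrib sq[unfolded q] algebra_simps)
  then have "x ^ q * t = x" unfolding t x_def by (simp add: mult.commute add.commute)
  moreover have "x ^ q = x ^ (q - 1) * x" 
    using \<open>q > 1\<close> by (metis Suc_diff_1 less_trans power_Suc2 zero_less_one)
  ultimately have "x ^ (q - 1) * t = 1" using w by (simp add: x_def[symmetric])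
  then have "(inverse x) ^ (q - 1) = t" by (simp add: power_inverse inverse_unique mult.commute)
  then show ?thesis using w by (metis x_def inverse_nonzero_iff_nonzero)
qed

text \<open>
  The map \<open>x \<mapsto> x ^ (q - 1)\<close> from the units onto the elements of norm one intertwines
  \<open>x \<mapsto> x ^ r * h (x ^ (q - 1))\<close> with the induced map \<open>t \<mapsto> t ^ r * h t ^ (q - 1)\<close>, and on each
  fibre, a coset of the group of \<open>(q - 1)\<close>-th roots of unity, the map acts as \<open>r\<close>-th powering
  up to a constant. So bijectivity splits into bijectivity on the base and on the fibres.
\<close>

lemma permutation_criterion:
  fixes h :: "'a::finite_field \<Rightarrow> 'a"
  assumes q: "q = CHAR('a) ^ k" and card: "card (UNIV :: 'a set) = q ^ 2"
    and "q > 1" and "r > 0" and h: "\<And>t. t ^ (q + 1) = 1 \<Longrightarrow> h t \<noteq> 0"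
  shows "bij (\<lambda>x. x ^ r * h (x ^ (q - 1))) \<longleftrightarrow>
    coprime r (q - 1) \<and> inj_on (\<lambda>t. t ^ r * h t ^ (q - 1)) {t. t ^ (q + 1) = 1}"
    (is "bij ?f \<longleftrightarrow> _ \<and> inj_on ?g _")
proof -
  have N: "card (UNIV :: 'a set) - 1 = (q - 1) * (q + 1)"
    using \<open>q > 1\<close> by (simp add: card power2_eq_square algebra_simps)
  have mu: "(x ^ (q - 1)) ^ (q + 1) = 1" if "x \<noteq> 0" for x :: 'a
    using finite_field_power_card_minus_1[OF that] by (simp only: N power_mult)
  have f0: "?f x \<noteq> 0" if "x \<noteq> 0" for x using that h[OF mu[OF that]] by simp
  have f00: "?f 0 = 0" using \<open>r > 0\<close> by simp
  have fg: "?f x ^ (q - 1) = ?g (x ^ (q - 1))" for x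
    by (simp add: power_mult_distrib mult.commute flip: power_mult)
  have "bij ?f \<longleftrightarrow> inj ?f"
    using finite_UNIV_inj_surj[of ?f] by (auto simp: bij_def)
  also have "inj ?f \<longleftrightarrow> coprime r (q - 1) \<and> inj_on ?g {t. t ^ (q + 1) = 1}"
  proof (intro iffI conjI)
    assume inj: "inj ?f"
    show cop: "coprime r (q - 1)"
    proof (rule ccontr)
      define d where "d = gcd r (q - 1)"
      assume "\<not> coprime r (q - 1)"
      then have "d > 1" using \<open>r > 0\<close> by (simp add: d_def coprime_iff_gcd_eq_1 nat_neq_iff)
      moreover have "d dvd card (UNIV :: 'a set) - 1" unfolding N d_def by (intro dvd_mult2 gcd_dvd2)
      ultimately obtain z :: 'a where z: "z \<noteq> 1" "z ^ d = 1"
        using exists_nontrivial_root_of_unity by blast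
      have "z ^ r = 1" "z ^ (q - 1) = 1"
        by (metis d_def dvdE gcd_dvd1 gcd_dvd2 power_mult power_one z(2))+
      then have "?f z = ?f 1" by simp
      then have "z = 1" by (rule injD[OF inj])
      with z(1) show False by simp
    qed
    show "inj_on ?g {t. t ^ (q + 1) = 1}"
    proof (rule inj_onI, unfold mem_Collect_eq)
      fix t1 t2 :: 'a
      assume t: "t1 ^ (q + 1) = 1" "t2 ^ (q + 1) = 1" and g: "?g t1 = ?g t2"
      obtain x1 where x1: "x1 \<noteq> 0" "x1 ^ (q - 1) = t1" using hilbert_90[OF q card \<open>q > 1\<close> t(1)] by blast
      obtain x2 where x2: "x2 \<noteq> 0" "x2 ^ (q - 1) = t2" using hilbert_90[OF q card \<open>q > 1\<close> t(2)] by blast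
      define c where "c = ?f x2 / ?f x1"
      have "?f x1 ^ (q - 1) = ?g (x1 ^ (q - 1))" by (rule fg)
      also have "\<dots> = ?g (x2 ^ (q - 1))" unfolding x1(2) x2(2) by (rule g)
      also have "\<dots> = ?f x2 ^ (q - 1)" by (rule fg[symmetric])
      finally have "?f x1 ^ (q - 1) = ?f x2 ^ (q - 1)" .
      then have c1: "c ^ (q - 1) = 1"
        using power_not_zero[OF f0[OF x1(1)]] unfolding c_def power_divide by (metis divide_self)
      obtain a b where ab: "r * a = (q - 1) * b + 1"
        using bezout_nat[of r "q - 1"] cop \<open>r > 0\<close> by auto
      \<comment> \<open>An \<open>r\<close>-th root \<open>d\<close> of \<open>c\<close> inside the group of \<open>(q - 1)\<close>-th roots of unity: replacing \<open>x1\<close> by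
        \<open>d * x1\<close> keeps \<open>t1\<close> and multiplies the value of the function by \<open>c\<close>.\<close>
      define d where "d = c ^ a"
      have "d ^ r = c ^ (r * a)" by (simp add: d_def mult.commute flip: power_mult)
      also have "\<dots> = c" by (simp only: ab power_add power_mult c1) simp
      finally have dr: "d ^ r = c" .
      have d1: "d ^ (q - 1) = 1" using c1 by (metis d_def mult.commute power_mult power_one)
      have "?f (d * x1) = c * ?f x1" by (simp only: power_mult_distrib dr d1 mult_1_left mult.assoc)
      also have "\<dots> = ?f x2" unfolding c_def using f0[OF x1(1)] by simp
      finally have "d * x1 = x2" by (rule injD[OF inj])
      then show "t1 = t2" using x1 x2 d1 by (auto simp: power_mult_distrib)
    qed
  next
    assume *: "coprime r (q - 1) \<and> inj_on ?g {t. t ^ (q + 1) = 1}"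
    show "inj ?f"
    proof (rule injI)
      fix x y assume eq: "?f x = ?f y"
      show "x = y"
      proof (cases "x = 0 \<or> y = 0")
        case True
        then show ?thesis using eq f0 f00 by metis
      next
        case False
        then have xy: "x \<noteq> 0" "y \<noteq> 0" by auto
        have "?g (x ^ (q - 1)) = ?g (y ^ (q - 1))" using eq by (simp only: flip: fg)
        then have e: "x ^ (q - 1) = y ^ (q - 1)"
          using * mu[OF xy(1)] mu[OF xy(2)] by (auto dest: inj_onD)
        then have "x ^ r = y ^ r" using eq h[OF mu[OF xy(2)]] by simp
        then show ?thesis using power_inj_coprime[OF xy _ e] * by blast
      qed
    qed
  qed
  finally show ?thesis .
qed

section \<open>Powers of a degree-one map\<close>

text \<open>
  The displayed equation is the denominator-free form of \<open>\<sigma>(s) ^ n = \<sigma>(t) ^ n\<close>, where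
  \<open>\<sigma>(x) = (x + v) / (v x + 1)\<close>. If \<open>v\<close> lies in the subfield of \<open>q\<close> elements, \<open>\<sigma>\<close> permutes the
  group of norm-one elements, which has order \<open>q + 1\<close>. If \<open>v\<close> has norm one, \<open>\<sigma>\<close> maps that group
  bijectively to the projective line over the subfield, on which the \<open>n\<close>-th power map fixes
  \<open>0\<close> and \<open>\<infinity>\<close>, so that only the units, a group of order \<open>q - 1\<close>, matter. In both cases the \<open>n\<close>-th
  power map acts on a group of order \<open>e\<close>.

  The proof cross-multiplies throughout, because in the second case \<open>\<sigma>\<close> takes the value \<open>\<infinity>\<close> on
  the norm-one group.
\<close>

lemma moebius_injective_iff_coprime:
  fixes v :: "'a::finite_field"
  assumes q: "q = CHAR('a) ^ k" and card: "card (UNIV :: 'a set) = q ^ 2" and "q > 1"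
    and v0: "v \<noteq> 0" and v2: "v ^ 2 \<noteq> 1"
    and e: "v ^ q = v \<and> e = q + 1 \<or> v ^ q * v = 1 \<and> e = q - 1"
    and "n > 0"
  shows "(\<forall>s t. s ^ (q + 1) = 1 \<longrightarrow> t ^ (q + 1) = 1 \<longrightarrow>
            ((s + v) * (v * t + 1)) ^ n = ((t + v) * (v * s + 1)) ^ n \<longrightarrow> s = t) \<longleftrightarrow> coprime n e"
    (is "?inj \<longleftrightarrow> _")
proof
  have e0: "e > 0" using e \<open>q > 1\<close> by auto
  have "v * v \<noteq> 1" using v2 by (simp add: power2_eq_square)
  have frob: "(x + v) ^ q = x ^ q + v ^ q" "(v * x + 1) ^ q = v ^ q * x ^ q + 1" for x
    by (simp_all add: q frobenius_add power_mult_distrib)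
  have swap: "s = t" if "(s + v) * (v * t + 1) = (t + v) * (v * s + 1)" for s t
  proof -
    have "(1 - v * v) * (s - t) = 0" using that by (simp add: algebra_simps)
    then show ?thesis using \<open>v * v \<noteq> 1\<close> by simp
  qed
  {
    assume inj: ?inj
    show "coprime n e"
    proof (rule ccontr)
      assume nc: "\<not> coprime n e"
      define d where "d = gcd n e"
      have "d > 1" using nc e0 by (simp add: d_def coprime_iff_gcd_eq_1 nat_neq_iff)
      moreover have "d dvd card (UNIV :: 'a set) - 1"
      proof -
        have "card (UNIV :: 'a set) - 1 = (q - 1) * (q + 1)"
          using \<open>q > 1\<close> by (simp add: card power2_eq_square algebra_simps)
        then have "e dvd card (UNIV :: 'a set) - 1" using e by (metis dvd_triv_left dvd_triv_right)
        then show ?thesis using d_def dvd_trans gcd_dvd2 by blast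
      qed
      ultimately obtain z :: 'a where z: "z \<noteq> 1" "z ^ d = 1"
        using exists_nontrivial_root_of_unity by blast
      have zn: "z ^ n = 1" and ze: "z ^ e = 1"
        by (metis d_def dvdE gcd_dvd1 gcd_dvd2 power_mult power_one z(2))+
      have z0: "z \<noteq> 0" using ze e0 by (auto simp: power_0_left)
      have qz: "v ^ q = v \<and> z ^ q * z = 1 \<or> v ^ q * v = 1 \<and> z ^ q = z"
        using e
      proof
        assume "v ^ q = v \<and> e = q + 1"
        then show ?thesis using ze by (simp add: mult.commute)
      next
        assume *: "v ^ q * v = 1 \<and> e = q - 1"
        have "z ^ q = z ^ (q - 1) * z"
          using \<open>q > 1\<close> by (metis Suc_diff_1 less_trans power_Suc2 zero_less_one)
        then show ?thesis using * ze by simp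
      qed
      have nz: "1 - v * z \<noteq> 0"
      proof
        assume "1 - v * z = 0"
        then have vz: "v * z = 1" by simp
        then have "v ^ q * z ^ q = 1" by (metis power_mult_distrib power_one)
        with qz vz have "v = z" using v0 z0 by (metis mult.commute mult_right_cancel)
        with vz \<open>v * v \<noteq> 1\<close> show False by simp
      qed
      \<comment> \<open>\<open>x\<close> is the preimage of \<open>z\<close> under \<open>x \<mapsto> (x + v) / (v x + 1)\<close>. As \<open>1\<close> is a fixed point of that map
        and \<open>z ^ n = 1\<close>, the points \<open>x\<close> and \<open>1\<close> collide.\<close>
      define x where "x = (z - v) / (1 - v * z)"
      have "(z ^ q - v ^ q) * (z - v) = (1 - v ^ q * z ^ q) * (1 - v * z)"
        using qz
      proof
        assume *: "v ^ q = v \<and> z ^ q * z = 1"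
        then have "(z ^ q - v) * (z - v) = 1 - v * z ^ q - v * z + v * v"
          by (simp add: algebra_simps)
        moreover have "(1 - v * z ^ q) * (1 - v * z) = 1 - v * z ^ q - v * z + v * v * (z ^ q * z)"
          by (simp add: algebra_simps)
        ultimately show ?thesis using * by simp
      next
        assume *: "v ^ q * v = 1 \<and> z ^ q = z"
        have "(z - v ^ q) * (z - v) = z * z - v ^ q * z - v * z + v ^ q * v"
          by (simp add: algebra_simps)
        moreover have "(1 - v ^ q * z) * (1 - v * z) = 1 - v ^ q * z - v * z + (v ^ q * v) * (z * z)"
          by (simp add: algebra_simps)
        ultimately show ?thesis using * by simp
      qed
      moreover have "(z - v) ^ q = z ^ q - v ^ q" "(1 - v * z) ^ q = 1 - v ^ q * z ^ q"
        by (simp_all add: q frobenius_diff power_mult_distrib)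
      ultimately have E: "(z - v) ^ q * (z - v) = (1 - v * z) ^ q * (1 - v * z)"
        by simp
      have "x ^ (q + 1) = ((z - v) ^ q * (z - v)) / ((1 - v * z) ^ q * (1 - v * z))"
        by (simp add: x_def power_divide mult.commute)
      also have "\<dots> = 1" unfolding E using nz by simp
      finally have x: "x ^ (q + 1) = 1" .
      have "x + v = z * (1 - v * v) / (1 - v * z)" "v * x + 1 = (1 - v * v) / (1 - v * z)"
        using nz by (simp_all add: x_def field_simps)
      then have xv: "x + v = z * (v * x + 1)" by simp
      have "((x + v) * (v * 1 + 1)) ^ n = ((1 + v) * (v * x + 1)) ^ n"
        unfolding xv power_mult_distrib zn by (simp add: mult.commute add.commute)
      then have "x = 1" using inj x by (metis power_one)
      then have "(z - 1) * (1 + v) = 0" using nz by (simp add: x_def field_simps)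
      moreover have "1 + v \<noteq> 0"
      proof
        assume "1 + v = 0"
        then have "v = - 1" by (simp add: eq_neg_iff_add_eq_0 add.commute)
        then show False using v2 by simp
      qed
      ultimately show False using z(1) by simp
    qed
  next
    assume cop: "coprime n e"
    show ?inj
    proof (intro allI impI)
      fix s t :: 'a
      assume s: "s ^ (q + 1) = 1" and t: "t ^ (q + 1) = 1"
        and eq: "((s + v) * (v * t + 1)) ^ n = ((t + v) * (v * s + 1)) ^ n"
      \<comment> \<open>Without quotients: the \<open>e\<close>-th powers of the images of \<open>s\<close> and \<open>t\<close> agree, both being \<open>1\<close>.\<close>
      have conj: "((s + v) * (v * t + 1)) ^ e = ((t + v) * (v * s + 1)) ^ e"
        if nz: "(s + v) * (v * t + 1) \<noteq> 0" "(t + v) * (v * s + 1) \<noteq> 0"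
        using e
      proof
        assume *: "v ^ q = v \<and> e = q + 1"
        have "(x + v) ^ e = (v * x + 1) ^ e" if x: "x ^ (q + 1) = 1" for x
        proof -
          have "(x + v) ^ e = (x ^ q + v) * (x + v)"
            using * by (simp add: mult.commute frob)
          also have "\<dots> = x ^ (q + 1) + v * x ^ q + v * x + v * v"
            by (simp add: algebra_simps)
          also have "\<dots> = v * v * x ^ (q + 1) + v * x ^ q + v * x + 1"
            unfolding x by simp
          also have "\<dots> = (v * x ^ q + 1) * (v * x + 1)"
            by (simp add: algebra_simps)
          also have "\<dots> = (v * x + 1) ^ e"
            using * by (simp add: mult.commute frob)
          finally show ?thesis .
        qed
        then show ?thesis using s t by (simp add: power_mult_distrib mult.commute)
      next
        assume *: "v ^ q * v = 1 \<and> e = q - 1"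
        have conj: "(x + v) ^ q * (v * x) = x + v" "(v * x + 1) ^ q * (v * x) = v * x + 1"
          if x: "x ^ (q + 1) = 1" for x
        proof -
          have "(x + v) ^ q * (v * x) = v * x ^ (q + 1) + (v ^ q * v) * x"
               "(v * x + 1) ^ q * (v * x) = (v ^ q * v) * x ^ (q + 1) + v * x"
            unfolding frob by (simp_all add: algebra_simps)
          then show "(x + v) ^ q * (v * x) = x + v" "(v * x + 1) ^ q * (v * x) = v * x + 1"
            unfolding x using * by (simp_all add: add.commute)
        qed
        define d where "d = (v * s) * (v * t)"
        have inv: "y ^ (q - 1) * d = 1" if "y ^ q * d = y" "y \<noteq> 0" for y
        proof -
          have "y ^ q = y ^ (q - 1) * y"
            using \<open>q > 1\<close> by (metis Suc_diff_1 less_trans power_Suc2 zero_less_one)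
          then have "(y ^ (q - 1) * d) * y = 1 * y" using that(1) by (simp add: mult_ac)
          then show ?thesis using that(2) by (metis mult_right_cancel)
        qed
        have "((s + v) * (v * t + 1)) ^ q * d
            = ((s + v) ^ q * (v * s)) * ((v * t + 1) ^ q * (v * t))"
          "((t + v) * (v * s + 1)) ^ q * d
            = ((t + v) ^ q * (v * t)) * ((v * s + 1) ^ q * (v * s))"
          by (simp_all add: d_def power_mult_distrib mult_ac)
        then have "((s + v) * (v * t + 1)) ^ (q - 1) * d = 1"
          "((t + v) * (v * s + 1)) ^ (q - 1) * d = 1"
          by (intro inv nz; simp only: conj s t)+
        then show ?thesis using * by (metis mult_cancel_right mult_zero_right zero_neq_one)
      qed
      show "s = t"
      proof (cases "(s + v) * (v * t + 1) = 0 \<or> (t + v) * (v * s + 1) = 0")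
        \<comment> \<open>Here an image is \<open>0\<close> or \<open>\<infinity>\<close>; it can only collide with itself.\<close>
        case True
        then have zero: "(s + v) * (v * t + 1) = 0" "(t + v) * (v * s + 1) = 0"
          using eq \<open>n > 0\<close> by (metis power_0_left power_eq_0_iff not_gr_zero)+
        show ?thesis by (rule swap) (simp only: zero)
      next
        case False
        then have nz: "(s + v) * (v * t + 1) \<noteq> 0" "(t + v) * (v * s + 1) \<noteq> 0" by auto
        show ?thesis by (rule swap, rule power_inj_coprime[OF nz eq conj[OF nz] cop])
      qed
    qed
  }
qed

text \<open>
  Both equations say that two vectors are linearly dependent, and up to the factor \<open>c\<close> the
  vectors \<open>(k, h)\<close> are the images of \<open>(X, Y)\<close> under the matrix with rows \<open>(-1, v)\<close> and \<open>(v, -1)\<close>,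
  whose determinant \<open>1 - v\<^sup>2\<close> is nonzero.
\<close>

lemma fractional_linear_collision:
  fixes v :: "'a::field"
  assumes "v ^ 2 \<noteq> 1" "c \<noteq> 0"
    and "c * h1 = v * X1 - Y1" "c * k1 = v * Y1 - X1"
    and "c * h2 = v * X2 - Y2" "c * k2 = v * Y2 - X2"
  shows "k1 * h2 = k2 * h1 \<longleftrightarrow> X1 * Y2 = X2 * Y1"
proof -
  have "c * c * (k1 * h2 - k2 * h1) = (c * k1) * (c * h2) - (c * k2) * (c * h1)"
    by (simp add: algebra_simps)
  also have "\<dots> = (v ^ 2 - 1) * (X2 * Y1 - X1 * Y2)"
    unfolding assms(3-6) by (simp add: algebra_simps power2_eq_square)
  finally show ?thesis using assms(1,2) by (metis (no_types, lifting) eq_iff_diff_eq_0 mult_eq_0_iff)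
qed

text \<open>
  On the norm-one group the induced map is \<open>t \<mapsto> (t ^ n * h t ^ q) / h t\<close>, because \<open>r\<close> and \<open>n\<close>
  are congruent. If its numerator and denominator are the stated combinations of \<open>X\<close> and \<open>Y\<close>,
  it is a degree-one function of \<open>X / Y\<close>, and this ratio is \<open>\<sigma>(t) ^ n\<close> or its reciprocal. The
  denominator has no zero, since \<open>h t = 0\<close> would force \<open>X t = Y t = 0\<close>.
\<close>

lemma permutation_iff_coprime:
  fixes v :: "'a::finite_field" and h :: "'a \<Rightarrow> 'a"
  assumes q: "q = CHAR('a) ^ k" and card: "card (UNIV :: 'a set) = q ^ 2" and "q > 1"
    and v0: "v \<noteq> 0" and v2: "v ^ 2 \<noteq> 1"
    and e: "v ^ q = v \<and> e = q + 1 \<or> v ^ q * v = 1 \<and> e = q - 1"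
    and "n > 0" and r: "r > 0" "[r = n] (mod (q + 1))"
    and c: "c \<noteq> 0"
    and h: "\<And>t. t ^ (q + 1) = 1 \<Longrightarrow> c * h t = v * X t - Y t"
    and hq: "\<And>t. t ^ (q + 1) = 1 \<Longrightarrow> c * (t ^ n * h t ^ q) = v * Y t - X t"
    and l: "l \<noteq> 0"
    and XY: "(\<forall>t. X t = l * (t + v) ^ n \<and> Y t = l * (v * t + 1) ^ n) \<or>
             (\<forall>t. X t = l * (v * t + 1) ^ n \<and> Y t = l * (t + v) ^ n)"
  shows "bij (\<lambda>x. x ^ r * h (x ^ (q - 1))) \<longleftrightarrow> coprime r (q - 1) \<and> coprime n e"
proof -
  have vv: "v * v \<noteq> 1" using v2 by (simp add: power2_eq_square)
  have ht: "h t \<noteq> 0" if t: "t ^ (q + 1) = 1" for t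
  proof
    assume "h t = 0"
    then have 1: "v * X t = Y t" and 2: "v * Y t = X t"
      using h[OF t] hq[OF t] \<open>q > 1\<close> by (auto simp: power_0_left)
    then have "(v * v - 1) * X t = 0" by (simp add: algebra_simps)
    then have "X t = 0" "Y t = 0" using vv 1 by auto
    then have "t + v = 0" "v * t + 1 = 0" using XY l by auto
    then have "v * v = 1" by (metis add_eq_0_iff minus_mult_minus minus_minus mult.commute mult_minus_right)
    then show False using vv by simp
  qed
  have tr: "t ^ r = t ^ n" if t: "t ^ (q + 1) = 1" for t :: 'a
    using t r(2) by (rule power_cong_exponent)
  \<comment> \<open>On the norm-one group the exponent \<open>q - 1\<close> turns into a quotient by \<open>h\<close>, and \<open>r\<close> may be
    exchanged for \<open>n\<close>; this is what makes the two linear formulas for \<open>h\<close> applicable.\<close>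
  have g: "t ^ r * h t ^ (q - 1) = t ^ n * h t ^ q / h t" if t: "t ^ (q + 1) = 1" for t
  proof -
    have "h t ^ q = h t ^ (q - 1) * h t"
      using \<open>q > 1\<close> by (metis Suc_diff_1 less_trans power_Suc2 zero_less_one)
    then show ?thesis using ht[OF t] tr[OF t] by simp
  qed
  have coll: "s ^ r * h s ^ (q - 1) = t ^ r * h t ^ (q - 1) \<longleftrightarrow>
      ((s + v) * (v * t + 1)) ^ n = ((t + v) * (v * s + 1)) ^ n"
    if s: "s ^ (q + 1) = 1" and t: "t ^ (q + 1) = 1" for s t
  proof -
    have "s ^ r * h s ^ (q - 1) = t ^ r * h t ^ (q - 1) \<longleftrightarrow>
      (s ^ n * h s ^ q) * h t = (t ^ n * h t ^ q) * h s"
      unfolding g[OF s] g[OF t] using ht[OF s] ht[OF t] by (simp add: frac_eq_eq)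
    also have "\<dots> \<longleftrightarrow> X s * Y t = X t * Y s"
      by (rule fractional_linear_collision[OF v2 c h[OF s] hq[OF s] h[OF t] hq[OF t]])
    also have "\<dots> \<longleftrightarrow> ((s + v) * (v * t + 1)) ^ n = ((t + v) * (v * s + 1)) ^ n"
      using XY
    proof
      assume *: "\<forall>t. X t = l * (t + v) ^ n \<and> Y t = l * (v * t + 1) ^ n"
      show ?thesis using l by (simp add: * power_mult_distrib)
    next
      assume *: "\<forall>t. X t = l * (v * t + 1) ^ n \<and> Y t = l * (t + v) ^ n"
      show ?thesis using l by (auto simp: * power_mult_distrib mult.commute)
    qed
    finally show ?thesis .
  qed
  have "inj_on (\<lambda>t. t ^ r * h t ^ (q - 1)) {t. t ^ (q + 1) = 1} \<longleftrightarrow> coprime n e"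
    unfolding moebius_injective_iff_coprime[OF q card \<open>q > 1\<close> v0 v2 e \<open>n > 0\<close>, symmetric] inj_on_def
    using coll by blast
  moreover have "bij (\<lambda>x. x ^ r * h (x ^ (q - 1))) \<longleftrightarrow>
      coprime r (q - 1) \<and> inj_on (\<lambda>t. t ^ r * h t ^ (q - 1)) {t. t ^ (q + 1) = 1}"
    by (rule permutation_criterion[OF q card \<open>q > 1\<close> r(1), where h = h]) (rule ht)
  ultimately show ?thesis by blast
qed

section \<open>The two families of polynomials\<close>

text \<open>
  Whether \<open>Q\<close>-th powering fixes or inverts \<open>v\<close>, both linear forms in \<open>t ^ Q\<close> are, up to the same
  factor, \<open>Q\<close>-th powers of linear forms in \<open>t\<close>. In the second case the two forms trade places.
\<close>

lemma linear_factor_frobenius: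
  fixes v :: "'a::finite_field"
  assumes "Q = CHAR('a) ^ i"
  shows "v ^ Q = v \<Longrightarrow> t ^ Q + v = (t + v) ^ Q \<and> v * t ^ Q + 1 = (v * t + 1) ^ Q"
    and "v ^ Q * v = 1 \<Longrightarrow> t ^ Q + v = v * (v * t + 1) ^ Q \<and> v * t ^ Q + 1 = v * (t + v) ^ Q"
proof -
  have 1: "(t + v) ^ Q = t ^ Q + v ^ Q" "(v * t + 1) ^ Q = v ^ Q * t ^ Q + 1"
    by (simp_all add: assms frobenius_add power_mult_distrib)
  show "v ^ Q = v \<Longrightarrow> t ^ Q + v = (t + v) ^ Q \<and> v * t ^ Q + 1 = (v * t + 1) ^ Q"
    by (simp add: 1)
  assume *: "v ^ Q * v = 1"
  have "v * (v * t + 1) ^ Q = (v ^ Q * v) * t ^ Q + v" "v * (t + v) ^ Q = v * t ^ Q + v ^ Q * v"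
    unfolding 1 by (simp_all add: algebra_simps)
  then show "t ^ Q + v = v * (v * t + 1) ^ Q \<and> v * t ^ Q + 1 = v * (t + v) ^ Q"
    by (simp add: *)
qed

text \<open>
  With \<open>a = t ^ Q\<close>, \<open>b = t ^ R\<close>, \<open>c = t ^ S\<close>, the left-hand sides are, up to the factor
  \<open>v - v ^ 3\<close>, the denominator and the numerator of the induced map. Both are symmetric and
  multilinear in \<open>a\<close>, \<open>b\<close>, \<open>c\<close>, so each is a combination of the two products on the right as
  soon as its coefficients fit; the value of \<open>\<beta>\<close> is the one for which they do.
\<close>

lemma symmetric_case_identity:
  fixes a b c v \<beta> :: "'a::comm_ring_1"
  assumes \<beta>: "(v - v ^ 3) * \<beta> = v ^ 4 - 1"
  shows "(v - v ^ 3) * (a * b * c - a - b - c + \<beta>)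
      = v * ((a + v) * (b + v) * (c + v)) - (v * a + 1) * (v * b + 1) * (v * c + 1)"
    and "(v - v ^ 3) * (1 - b * c - a * c - a * b + \<beta> * (a * b * c))
      = v * ((v * a + 1) * (v * b + 1) * (v * c + 1)) - (a + v) * (b + v) * (c + v)"
proof -
  have \<beta>': "(v - v ^ 3) * (x + \<beta> * y) = (v - v ^ 3) * x + (v ^ 4 - 1) * y" for x y
    by (simp only: distrib_left mult.assoc[symmetric] \<beta>)
  show "(v - v ^ 3) * (a * b * c - a - b - c + \<beta>)
      = v * ((a + v) * (b + v) * (c + v)) - (v * a + 1) * (v * b + 1) * (v * c + 1)"
    using \<beta>'[of "a * b * c - a - b - c" "1"] by (simp add: algebra_simps eval_nat_numeral)
  show "(v - v ^ 3) * (1 - b * c - a * c - a * b + \<beta> * (a * b * c))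
      = v * ((v * a + 1) * (v * b + 1) * (v * c + 1)) - (a + v) * (b + v) * (c + v)"
    using \<beta>'[of "1 - b * c - a * c - a * b" "a * b * c"] by (simp add: algebra_simps eval_nat_numeral)
qed

text \<open>
  These arise from the symmetric identities by replacing \<open>c\<close> with \<open>1 / c\<close> and clearing
  denominators.
\<close>

lemma mixed_case_identity:
  fixes a b c v \<beta> :: "'a::comm_ring_1"
  assumes \<beta>: "(v - v ^ 3) * \<beta> = v ^ 4 - 1"
  shows "(v - v ^ 3) * (a * b - a * c - b * c + \<beta> * c - 1)
      = v * ((a + v) * (b + v) * (v * c + 1)) - (v * a + 1) * (v * b + 1) * (c + v)"
    and "(v - v ^ 3) * (c - b - a + \<beta> * (a * b) - a * b * c)
      = v * ((v * a + 1) * (v * b + 1) * (c + v)) - (a + v) * (b + v) * (v * c + 1)"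
proof -
  have \<beta>': "(v - v ^ 3) * (x + \<beta> * y) = (v - v ^ 3) * x + (v ^ 4 - 1) * y" for x y
    by (simp only: distrib_left mult.assoc[symmetric] \<beta>)
  show "(v - v ^ 3) * (a * b - a * c - b * c + \<beta> * c - 1)
      = v * ((a + v) * (b + v) * (v * c + 1)) - (v * a + 1) * (v * b + 1) * (c + v)"
    using \<beta>'[of "a * b - a * c - b * c - 1" "c"] by (simp add: algebra_simps eval_nat_numeral)
  show "(v - v ^ 3) * (c - b - a + \<beta> * (a * b) - a * b * c)
      = v * ((v * a + 1) * (v * b + 1) * (c + v)) - (a + v) * (b + v) * (v * c + 1)"
    using \<beta>'[of "c - b - a - a * b * c" "a * b"] by (simp add: algebra_simps eval_nat_numeral)
qed

text \<open>
  Raising to the power \<open>q\<close> inverts elements of norm one; this computes the numerator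
  \<open>t ^ n * h t ^ q\<close> of the induced map from \<open>h\<close>.
\<close>

lemma symmetric_case_reciprocal:
  fixes a b c a' b' c' \<beta> :: "'a::comm_ring_1"
  assumes "a' * a = 1" "b' * b = 1" "c' * c = 1"
  shows "a * b * c * (a' * b' * c' - a' - b' - c' + \<beta>)
      = 1 - b * c - a * c - a * b + \<beta> * (a * b * c)"
proof -
  have "a * b * c * (a' * b' * c' - a' - b' - c' + \<beta>)
      = (a' * a) * (b' * b) * (c' * c) - (a' * a) * (b * c) - (b' * b) * (a * c) - (c' * c) * (a * b)
        + \<beta> * (a * b * c)"
    by (simp add: algebra_simps)
  then show ?thesis by (simp add: assms)
qed

lemma mixed_case_reciprocal:
  fixes a b c a' b' c' \<beta> :: "'a::comm_ring_1"
  assumes "a' * a = 1" "b' * b = 1" "c' * c = 1"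
  shows "a * b * c * (a' * b' - a' * c' - b' * c' + \<beta> * c' - 1)
      = c - b - a + \<beta> * (a * b) - a * b * c"
proof -
  have "a * b * c * (a' * b' - a' * c' - b' * c' + \<beta> * c' - 1)
      = (a' * a) * (b' * b) * c - (a' * a) * (c' * c) * b - (b' * b) * (c' * c) * a
        + (c' * c) * (\<beta> * (a * b)) - a * b * c"
    by (simp add: algebra_simps)
  then show ?thesis by (simp add: assms)
qed

text \<open>
  The hypothesis says \<open>\<beta> = - (v + 1 / v)\<close>, which the \<open>q\<close>-th power map preserves, whether it
  fixes or inverts \<open>v\<close>.
\<close>

lemma trace_coefficient_fixed:
  fixes v \<beta> :: "'a::finite_field"
  assumes q: "q = CHAR('a) ^ k" and v0: "v \<noteq> 0" and v2: "v ^ 2 \<noteq> 1"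
    and vq: "v ^ q = v \<or> v ^ q * v = 1"
    and \<beta>: "(v - v ^ 3) * \<beta> = v ^ 4 - 1"
  shows "\<beta> ^ q = \<beta>"
proof -
  have "v * (1 - v ^ 2) * (\<beta> * v + (v ^ 2 + 1)) = 0"
    using \<beta> by algebra
  then have "\<beta> * v + (v ^ 2 + 1) = 0"
    using v0 v2 by simp
  then have "\<beta> = - (v + inverse v)"
    using v0 by (simp add: field_simps power2_eq_square eq_neg_iff_add_eq_0)
  moreover have "v ^ q + inverse (v ^ q) = v + inverse v"
    using vq
  proof
    assume "v ^ q * v = 1"
    then have "inverse (v ^ q) = v" by (rule inverse_unique)
    then show ?thesis by (metis add.commute inverse_inverse_eq)
  qed simp
  ultimately show ?thesis
    using frobenius_diff[of 0 "v + inverse v" k] frobenius_add[of v "inverse v" k]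
    by (simp add: q power_inverse)
qed

lemma power_conjugate:
  fixes t :: "'a::comm_monoid_mult"
  assumes "t ^ (q + 1) = 1"
  shows "(t ^ Z) ^ q * t ^ Z = 1"
proof -
  have "(t ^ Z) ^ q * t ^ Z = (t ^ (q + 1)) ^ Z"
    by (simp add: power_mult_distrib mult.commute flip: power_mult)
  then show ?thesis using assms by simp
qed

lemma permutation_symmetric_case:
  fixes v \<beta> :: "'a::finite_field"
  assumes q: "q = CHAR('a) ^ k" and card: "card (UNIV :: 'a set) = q ^ 2" and q1: "q > 1"
    and v0: "v \<noteq> 0" and v2: "v ^ 2 \<noteq> 1"
    and e: "v ^ q = v \<and> e = q + 1 \<or> v ^ q * v = 1 \<and> e = q - 1"
    and \<beta>: "(v - v ^ 3) * \<beta> = v ^ 4 - 1"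
    and QRS: "Q = CHAR('a) ^ i" "R = CHAR('a) ^ j" "S = CHAR('a) ^ l"
    and n: "n = Q + R + S" and r: "r > 0" "[r = n] (mod (q + 1))"
    and vQRS: "v ^ Q = v \<and> v ^ R = v \<and> v ^ S = v \<or>
               v ^ Q * v = 1 \<and> v ^ R * v = 1 \<and> v ^ S * v = 1"
    and h: "\<And>t. h t = t ^ Q * t ^ R * t ^ S - t ^ Q - t ^ R - t ^ S + \<beta>"
  shows "bij (\<lambda>x. x ^ r * h (x ^ (q - 1))) \<longleftrightarrow> coprime r (q - 1) \<and> coprime n e"
proof -
  define X where "X t = (t ^ Q + v) * (t ^ R + v) * (t ^ S + v)" for t
  define Y where "Y t = (v * t ^ Q + 1) * (v * t ^ R + 1) * (v * t ^ S + 1)" for t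
  have \<kappa>: "v - v ^ 3 \<noteq> 0"
    using v0 v2 by (simp add: power3_eq_cube power2_eq_square)
  have n0: "n > 0" using n QRS by simp
  have "\<exists>l. l \<noteq> 0 \<and>
         ((\<forall>t. X t = l * (t + v) ^ n \<and> Y t = l * (v * t + 1) ^ n) \<or>
          (\<forall>t. X t = l * (v * t + 1) ^ n \<and> Y t = l * (t + v) ^ n))"
    using vQRS
  proof
    assume *: "v ^ Q = v \<and> v ^ R = v \<and> v ^ S = v"
    then have "X t = 1 * (t + v) ^ n \<and> Y t = 1 * (v * t + 1) ^ n" for t
      by (simp add: X_def Y_def linear_factor_frobenius(1)[OF QRS(1)] linear_factor_frobenius(1)[OF QRS(2)]
        linear_factor_frobenius(1)[OF QRS(3)] n power_add)
    then show ?thesis by (metis one_neq_zero)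
  next
    assume *: "v ^ Q * v = 1 \<and> v ^ R * v = 1 \<and> v ^ S * v = 1"
    then have "X t = v ^ 3 * (v * t + 1) ^ n \<and> Y t = v ^ 3 * (t + v) ^ n" for t
      by (simp add: X_def Y_def linear_factor_frobenius(2)[OF QRS(1)] linear_factor_frobenius(2)[OF QRS(2)]
        linear_factor_frobenius(2)[OF QRS(3)] n power_add power3_eq_cube mult_ac)
    then show ?thesis using v0 by (metis power_not_zero)
  qed
  then obtain l where l: "l \<noteq> 0"
    "(\<forall>t. X t = l * (t + v) ^ n \<and> Y t = l * (v * t + 1) ^ n) \<or>
     (\<forall>t. X t = l * (v * t + 1) ^ n \<and> Y t = l * (t + v) ^ n)" by blast
  have \<beta>q: "\<beta> ^ q = \<beta>" by (rule trace_coefficient_fixed[OF q v0 v2 _ \<beta>]) (use e in blast)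
  show ?thesis
  proof (rule permutation_iff_coprime[OF q card q1 v0 v2 e n0 r \<kappa> _ _ l])
    fix t :: 'a assume t: "t ^ (q + 1) = 1"
    show "(v - v ^ 3) * h t = v * X t - Y t"
      unfolding h X_def Y_def by (rule symmetric_case_identity(1)[OF \<beta>])
    have inv: "(t ^ Z) ^ q * t ^ Z = 1" for Z by (rule power_conjugate[OF t])
    have "h t ^ q = (t ^ Q) ^ q * (t ^ R) ^ q * (t ^ S) ^ q - (t ^ Q) ^ q - (t ^ R) ^ q - (t ^ S) ^ q + \<beta>"
      unfolding h by (simp only: q frobenius_add frobenius_diff power_mult_distrib) (simp only: \<beta>q flip: q)
    then have "t ^ n * h t ^ q = 1 - t ^ R * t ^ S - t ^ Q * t ^ S - t ^ Q * t ^ R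
        + \<beta> * (t ^ Q * t ^ R * t ^ S)"
      by (simp only: n power_add symmetric_case_reciprocal[OF inv inv inv])
    then show "(v - v ^ 3) * (t ^ n * h t ^ q) = v * Y t - X t"
      unfolding X_def Y_def symmetric_case_identity(2)[OF \<beta>, symmetric] by simp
  qed
qed

lemma permutation_mixed_case:
  fixes v \<beta> :: "'a::finite_field"
  assumes q: "q = CHAR('a) ^ k" and card: "card (UNIV :: 'a set) = q ^ 2" and q1: "q > 1"
    and v0: "v \<noteq> 0" and v2: "v ^ 2 \<noteq> 1"
    and e: "v ^ q = v \<and> e = q + 1 \<or> v ^ q * v = 1 \<and> e = q - 1"
    and \<beta>: "(v - v ^ 3) * \<beta> = v ^ 4 - 1"
    and QRS: "Q = CHAR('a) ^ i" "R = CHAR('a) ^ j" "S = CHAR('a) ^ l"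
    and n: "n = Q + R + S" and r: "r > 0" "[r = n] (mod (q + 1))"
    and vQRS: "v ^ Q = v \<and> v ^ R = v \<and> v ^ S * v = 1 \<or>
               v ^ Q * v = 1 \<and> v ^ R * v = 1 \<and> v ^ S = v"
    and h: "\<And>t. h t = t ^ Q * t ^ R - t ^ Q * t ^ S - t ^ R * t ^ S + \<beta> * t ^ S - 1"
  shows "bij (\<lambda>x. x ^ r * h (x ^ (q - 1))) \<longleftrightarrow> coprime r (q - 1) \<and> coprime n e"
proof -
  \<comment> \<open>The forms in \<open>t ^ S\<close> are interchanged: \<open>S\<close> acts on \<open>v\<close> oppositely to \<open>Q\<close> and \<open>R\<close>, so in this
    arrangement all factors of \<open>X\<close> become powers of the same linear form in \<open>t\<close>.\<close>
  define X where "X t = (t ^ Q + v) * (t ^ R + v) * (v * t ^ S + 1)" for t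
  define Y where "Y t = (v * t ^ Q + 1) * (v * t ^ R + 1) * (t ^ S + v)" for t
  have \<kappa>: "v - v ^ 3 \<noteq> 0"
    using v0 v2 by (simp add: power3_eq_cube power2_eq_square)
  have n0: "n > 0" using n QRS by simp
  have "\<exists>l. l \<noteq> 0 \<and>
         ((\<forall>t. X t = l * (t + v) ^ n \<and> Y t = l * (v * t + 1) ^ n) \<or>
          (\<forall>t. X t = l * (v * t + 1) ^ n \<and> Y t = l * (t + v) ^ n))"
    using vQRS
  proof
    assume *: "v ^ Q = v \<and> v ^ R = v \<and> v ^ S * v = 1"
    then have "X t = v * (t + v) ^ n \<and> Y t = v * (v * t + 1) ^ n" for t
      by (simp add: X_def Y_def linear_factor_frobenius(1)[OF QRS(1)] linear_factor_frobenius(1)[OF QRS(2)]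
        linear_factor_frobenius(2)[OF QRS(3)] n power_add mult_ac)
    then show ?thesis using v0 by blast
  next
    assume *: "v ^ Q * v = 1 \<and> v ^ R * v = 1 \<and> v ^ S = v"
    then have "X t = v ^ 2 * (v * t + 1) ^ n \<and> Y t = v ^ 2 * (t + v) ^ n" for t
      by (simp add: X_def Y_def linear_factor_frobenius(2)[OF QRS(1)] linear_factor_frobenius(2)[OF QRS(2)]
        linear_factor_frobenius(1)[OF QRS(3)] n power_add power2_eq_square mult_ac)
    then show ?thesis using v0 by (metis power_not_zero)
  qed
  then obtain l where l: "l \<noteq> 0"
    "(\<forall>t. X t = l * (t + v) ^ n \<and> Y t = l * (v * t + 1) ^ n) \<or>
     (\<forall>t. X t = l * (v * t + 1) ^ n \<and> Y t = l * (t + v) ^ n)" by blast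
  have \<beta>q: "\<beta> ^ q = \<beta>" by (rule trace_coefficient_fixed[OF q v0 v2 _ \<beta>]) (use e in blast)
  show ?thesis
  proof (rule permutation_iff_coprime[OF q card q1 v0 v2 e n0 r \<kappa> _ _ l])
    fix t :: 'a assume t: "t ^ (q + 1) = 1"
    show "(v - v ^ 3) * h t = v * X t - Y t"
      unfolding h X_def Y_def by (rule mixed_case_identity(1)[OF \<beta>])
    have inv: "(t ^ Z) ^ q * t ^ Z = 1" for Z by (rule power_conjugate[OF t])
    have "h t ^ q = (t ^ Q) ^ q * (t ^ R) ^ q - (t ^ Q) ^ q * (t ^ S) ^ q - (t ^ R) ^ q * (t ^ S) ^ q
        + \<beta> * (t ^ S) ^ q - 1"
      unfolding h
      by (simp only: q frobenius_add frobenius_diff power_mult_distrib power_one) (simp only: \<beta>q flip: q)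
    then have "t ^ n * h t ^ q = t ^ S - t ^ R - t ^ Q + \<beta> * (t ^ Q * t ^ R) - t ^ Q * t ^ R * t ^ S"
      by (simp only: n power_add mixed_case_reciprocal[OF inv inv inv])
    then show "(v - v ^ 3) * (t ^ n * h t ^ q) = v * Y t - X t"
      unfolding X_def Y_def mixed_case_identity(2)[OF \<beta>, symmetric] by simp
  qed
qed

section \<open>The coefficient and the exponents in terms of the root of unity\<close>

text \<open>
  Multiplying by \<open>v\<close> turns \<open>b = c\<close> into \<open>v\<^sup>2 + c v + 1 = 0\<close>.
\<close>

lemma primitive_root_trace_iff:
  fixes v b :: "'a::field"
  assumes m3: "m \<ge> 3" and "primitive_root_of_unity m v" and bv: "b * v = - (v * v + 1)"
  shows "b \<in> {0, 1, - 1} \<longleftrightarrow> m \<in> {3, 4, 6}"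
proof -
  have m: "v ^ m = 1" "m > 0" "\<And>j. 0 < j \<Longrightarrow> j < m \<Longrightarrow> v ^ j \<noteq> 1"
    using assms(2) by (auto simp: primitive_root_of_unity_def)
  have v0: "v \<noteq> 0" using m(1,2) by (auto simp: power_0_left)
  have vv: "v * v \<noteq> 1" using m(3)[of 2] m3 by (simp add: power2_eq_square)
  then have v1: "v \<noteq> 1" "v \<noteq> - 1" by auto
  have dvd: "m dvd j" if "v ^ j = 1" for j
  proof -
    have "v ^ (j mod m) = 1" using that power_cong_exponent[OF m(1), of "j mod m" j] by simp
    then have "j mod m = 0" using m(2) m(3)[of "j mod m"] by (cases "j mod m = 0") auto
    then show ?thesis by auto
  qed
  have bv': "(b - c) * v = - (v * v + c * v + 1)" for c
    using bv by (simp add: left_diff_distrib)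
  have root: "b = c \<longleftrightarrow> v * v + c * v + 1 = 0" for c
  proof -
    have "b = c \<longleftrightarrow> (b - c) * v = 0" using v0 by simp
    then show ?thesis unfolding bv' by (simp only: neg_equal_0_iff_equal)
  qed
  have 0: "b = 0 \<longleftrightarrow> v * v + 1 = 0" and 1: "b = 1 \<longleftrightarrow> v * v + v + 1 = 0"
    and 2: "b = - 1 \<longleftrightarrow> v * v - v + 1 = 0"
    using root[of 0] root[of 1] root[of "- 1"] by simp_all
  \<comment> \<open>The three quadratics are the cyclotomic polynomials of orders 4, 3 and 6, so a root of one of
    them has order dividing 4, 3 or 6, also in characteristics 2 and 3.\<close>
  have factor: "(v * v - 1) * (v * v + 1) = v ^ 4 - 1" "(v - 1) * (v * v + v + 1) = v ^ 3 - 1"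
      "(v ^ 3 - 1) * ((v + 1) * (v * v - v + 1)) = v ^ 6 - 1"
    by (simp_all add: algebra_simps eval_nat_numeral)
  show ?thesis
  proof
    assume "b \<in> {0, 1, - 1}"
    then have "v ^ 4 = 1 \<or> v ^ 3 = 1 \<or> v ^ 6 = 1"
    proof (elim insertE emptyE)
      assume "b = 0"
      then have "v * v + 1 = 0" using 0 by simp
      then have "v ^ 4 = 1" using factor by simp
      then show ?thesis by simp
    next
      assume "b = 1"
      then have "v * v + v + 1 = 0" using 1 by simp
      then have "v ^ 3 = 1" using factor by simp
      then show ?thesis by simp
    next
      assume "b = - 1"
      then have "v * v - v + 1 = 0" using 2 by simp
      then have "v ^ 6 = 1" using factor by simp
      then show ?thesis by simp
    qed
    then have "m dvd 4 \<or> m dvd 3 \<or> m dvd 6" using dvd by blast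
    moreover from this have "m \<le> 6" by (auto dest: dvd_imp_le)
    ultimately have "m \<in> {3, 4, 5, 6}" "m \<noteq> 5" using m3 by auto
    then show "m \<in> {3, 4, 6}" by auto
  next
    assume "m \<in> {3, 4, 6}"
    then show "b \<in> {0, 1, - 1}"
    proof (elim insertE emptyE)
      assume "m = 3"
      then have "(v - 1) * (v * v + v + 1) = 0" using m(1) factor by simp
      then show ?thesis using v1 1 by simp
    next
      assume "m = 4"
      then have "(v * v - 1) * (v * v + 1) = 0" using m(1) factor by simp
      then show ?thesis using vv 0 by simp
    next
      assume 6: "m = 6"
      then have "v ^ 3 - 1 \<noteq> 0" using m(3)[of 3] by simp
      moreover have "(v ^ 3 - 1) * ((v + 1) * (v * v - v + 1)) = 0" using m(1) 6 factor(3) by simp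
      ultimately show ?thesis using v1 2 by (simp add: eq_neg_iff_add_eq_0 disj_commute)
    qed
  qed
qed

lemma power_eq_self_of_cong:
  fixes v :: "'a::field"
  assumes "v ^ m = 1" "[int Q = 1] (mod int m)"
  shows "v ^ Q = v"
proof -
  have "[Q = 1] (mod m)" using assms(2) cong_int_iff[of Q 1 m] by simp
  then show ?thesis using power_cong_exponent[OF assms(1), of Q 1] by simp
qed

lemma power_eq_inverse_of_cong:
  fixes v :: "'a::field"
  assumes "v ^ m = 1" "[int Q = - 1] (mod int m)"
  shows "v ^ Q * v = 1"
proof -
  have "int m dvd int (Q + 1)" using assms(2) by (simp add: cong_iff_dvd_diff add.commute)
  then have "m dvd Q + 1" by presburger
  then have "v ^ (Q + 1) = 1" using assms(1) by (metis dvdE power_mult power_one)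
  then show ?thesis by (simp add: mult.commute)
qed

section \<open>The characterization of the permutations\<close>

theorem theorem1p2:
  fixes p k q m :: nat
    and v b :: "'a::finite_field"
  assumes "prime p" and "k > 0" and "q = p ^ k"
    and "card (UNIV :: 'a set) = q ^ 2"
    and "m \<ge> 3"
    and "[int q = 1] (mod int m) \<or> [int q = -1] (mod int m)"
    and "primitive_root_of_unity m v"
    and "b = (1 - v ^ 4) / (v ^ 3 - v)"
  shows "(b \<in> {0, 1, -1} \<longleftrightarrow> m \<in> {3, 4, 6}) \<and>
    (\<forall>(Q::nat) (R::nat) (S::nat) (r::nat) (B::'a poly) (f::'a poly).
       (\<exists>i. Q = p ^ i) \<longrightarrow> (\<exists>i. R = p ^ i) \<longrightarrow> (\<exists>i. S = p ^ i) \<longrightarrow>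
       r > 0 \<longrightarrow> [r = Q + R + S] (mod (q + 1)) \<longrightarrow>
       (B = X_pow (Q + R + S) - X_pow Q - X_pow R - X_pow S + [:b:] \<and>
          cong_pm3 (int Q, int R, int S) (1, 1, 1) (int m) \<or>
        B = X_pow (Q + R) - X_pow (Q + S) - X_pow (R + S) + smult b (X_pow S) - 1 \<and>
          cong_pm3 (int Q, int R, int S) (1, 1, -1) (int m)) \<longrightarrow>
       f = X_pow r * pcompose B (X_pow (q - 1)) \<longrightarrow>
       (permutation_polynomial f \<longleftrightarrow>
          gcd r (q - 1) = 1 \<and>
          ([int q = 1] (mod int m) \<and> gcd (Q + R + S) (q + 1) = 1 \<or>
           [int q = -1] (mod int m) \<and> gcd (Q + R + S) (q - 1) = 1)))"
proof (intro conjI allI impI)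
  have m: "v ^ m = 1" "m > 0" "\<And>j. 0 < j \<Longrightarrow> j < m \<Longrightarrow> v ^ j \<noteq> 1"
    using assms(7) by (auto simp: primitive_root_of_unity_def)
  have v0: "v \<noteq> 0" using m(1,2) by (auto simp: power_0_left)
  have v2: "v ^ 2 \<noteq> 1" using m(3)[of 2] \<open>m \<ge> 3\<close> by simp
  have vv: "v * v \<noteq> 1" using v2 by (simp add: power2_eq_square)
  have ne: "v ^ 3 - v \<noteq> 0"
    using v0 vv by (simp add: power3_eq_cube)
  have b: "(v - v ^ 3) * b = v ^ 4 - 1"
    using ne assms(8) by (simp add: field_simps)
  have "v * (1 - v * v) * (b * v + (v * v + 1)) = 0"
    using b by algebra
  then have "b * v + (v * v + 1) = 0"
    using v0 vv by simp
  then have bv: "b * v = - (v * v + 1)"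
    by (simp only: eq_neg_iff_add_eq_0)
  show "b \<in> {0, 1, -1} \<longleftrightarrow> m \<in> {3, 4, 6}"
    using primitive_root_trace_iff[OF assms(5,7) bv] .
  have CH: "CHAR('a) = p"
    by (rule CHAR_eq_of_card_prime_power[OF assms(1), of "k * 2"]) (simp only: assms(3,4) power_mult)
  have q: "q = CHAR('a) ^ k" by (simp only: CH assms(3))
  have q1: "q > 1" unfolding assms(3) using assms(1,2) prime_gt_1_nat one_less_power by blast
  fix Q R S r :: nat and B f :: "'a poly"
  assume "\<exists>i. Q = p ^ i" "\<exists>i. R = p ^ i" "\<exists>i. S = p ^ i"
  then obtain i j l where QRS: "Q = CHAR('a) ^ i" "R = CHAR('a) ^ j" "S = CHAR('a) ^ l"
    unfolding CH by blast
  assume r: "r > 0" "[r = Q + R + S] (mod (q + 1))"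
  assume B: "B = X_pow (Q + R + S) - X_pow Q - X_pow R - X_pow S + [:b:] \<and>
          cong_pm3 (int Q, int R, int S) (1, 1, 1) (int m) \<or>
        B = X_pow (Q + R) - X_pow (Q + S) - X_pow (R + S) + smult b (X_pow S) - 1 \<and>
          cong_pm3 (int Q, int R, int S) (1, 1, -1) (int m)"
  assume f: "f = X_pow r * pcompose B (X_pow (q - 1))"
  have pf: "poly f = (\<lambda>x. x ^ r * poly B (x ^ (q - 1)))"
    by (simp add: f fun_eq_iff poly_pcompose poly_monom)
  note self = power_eq_self_of_cong[OF m(1)] and inv = power_eq_inverse_of_cong[OF m(1)]
  have key: "permutation_polynomial f \<longleftrightarrow> coprime r (q - 1) \<and> coprime (Q + R + S) e"
    if e: "v ^ q = v \<and> e = q + 1 \<or> v ^ q * v = 1 \<and> e = q - 1" for e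
    unfolding permutation_polynomial_def pf using B
  proof
    assume *: "B = X_pow (Q + R + S) - X_pow Q - X_pow R - X_pow S + [:b:] \<and>
          cong_pm3 (int Q, int R, int S) (1, 1, 1) (int m)"
    then have "v ^ Q = v \<and> v ^ R = v \<and> v ^ S = v \<or>
               v ^ Q * v = 1 \<and> v ^ R * v = 1 \<and> v ^ S * v = 1"
      by (auto simp: cong_pm3_def intro: self inv)
    then show "bij (\<lambda>x. x ^ r * poly B (x ^ (q - 1))) \<longleftrightarrow> coprime r (q - 1) \<and> coprime (Q + R + S) e"
      by (rule permutation_symmetric_case[OF q assms(4) q1 v0 v2 e b QRS refl r])
        (simp add: * poly_monom power_add)
  next
    assume *: "B = X_pow (Q + R) - X_pow (Q + S) - X_pow (R + S) + smult b (X_pow S) - 1 \<and>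
          cong_pm3 (int Q, int R, int S) (1, 1, -1) (int m)"
    then have "v ^ Q = v \<and> v ^ R = v \<and> v ^ S * v = 1 \<or>
               v ^ Q * v = 1 \<and> v ^ R * v = 1 \<and> v ^ S = v"
      by (auto simp: cong_pm3_def intro: self inv)
    then show "bij (\<lambda>x. x ^ r * poly B (x ^ (q - 1))) \<longleftrightarrow> coprime r (q - 1) \<and> coprime (Q + R + S) e"
      by (rule permutation_mixed_case[OF q assms(4) q1 v0 v2 e b QRS refl r])
        (simp add: * poly_monom power_add)
  qed
  have excl: "\<not> ([int q = 1] (mod int m) \<and> [int q = - 1] (mod int m))"
  proof
    assume "[int q = 1] (mod int m) \<and> [int q = - 1] (mod int m)"
    then have "v ^ q = v" "v ^ q * v = 1" using self inv by blast+
    then show False using vv by simp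
  qed
  show "permutation_polynomial f \<longleftrightarrow>
          gcd r (q - 1) = 1 \<and>
          ([int q = 1] (mod int m) \<and> gcd (Q + R + S) (q + 1) = 1 \<or>
           [int q = -1] (mod int m) \<and> gcd (Q + R + S) (q - 1) = 1)"
    using assms(6)
  proof
    assume *: "[int q = 1] (mod int m)"
    have "permutation_polynomial f \<longleftrightarrow> gcd r (q - 1) = 1 \<and> gcd (Q + R + S) (q + 1) = 1"
      using key[OF disjI1, OF conjI, OF self[OF *] refl] unfolding coprime_iff_gcd_eq_1 .
    moreover have "\<not> [int q = - 1] (mod int m)" using * excl by blast
    ultimately show ?thesis using * by (simp only: simp_thms)
  next
    assume *: "[int q = - 1] (mod int m)"
    have "permutation_polynomial f \<longleftrightarrow> gcd r (q - 1) = 1 \<and> gcd (Q + R + S) (q - 1) = 1"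
      using key[OF disjI2, OF conjI, OF inv[OF *] refl] unfolding coprime_iff_gcd_eq_1 .
    moreover have "\<not> [int q = 1] (mod int m)" using * excl by blast
    ultimately show ?thesis using * by (simp only: simp_thms)
  qed
qed

end
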